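(* Let $E$ be a finite set and let $L\subseteq\{\pm1\}^E$. The following statements are equivalent: (i) $L$ is ample; (ii) $|L|_A=|L_A|$ holds for all $A\subseteq E$; (iii) $\dim|L|_A=\dim|L_A|$ holds for all $A\subseteq E$.
   Context: $E$ is a finite set; for $B\subseteq E$, $\{\pm1\}^B$ and $\mathbb R^B$ are the sets of maps from $B$ to $\{-1,+1\}$ and $\mathbb R$, and $H(B)=[-1,+1]^B$. Ampleness: a set $A\subseteq E$ is shattered by $L\subseteq\{\pm1\}^E$ if $\{s|_A: s\in L\}=\{\pm1\}^A$. $L$ is ample if $\#L$ equals the number of subsets $A\subseteq E$ shattered by $L$. Projections: for $L\subseteq\{\pm1\}^E$ and $A\subseteq E$, $L_A:=\{s|_{E-A}: s\in L\}\subseteq\{\pm1\}^{E-A}$. For $K\subseteq\mathbb R^E$, $K_A:=\{r|_{E-A}: r\in K\}\subseteq\mathbb R^{E-A}$. Thus $|L|_A$ is the projection of $|L|$ while $|L_A|$ is the geometric realization of $L_A$ in $H(E-A)$. Geometric realization: for a finite set $B$ and $M\subseteq\{\pm1\}^B$, a face of $H(B)$ is a set $\{r\in H(B): r|_{B-C}=s_0\}$ with $C\subseteq B$ and $s_0\in\{\pm1\}^{B-C}$; $|M|$ is the union of all faces $F$ of $H(B)$ with $F\cap\{\pm1\}^B\subseteq M$. $\dim$ denotes topological dimension; both $|L|_A$ and $|L_A|$ are finite unions of faces of $H(E-A)$, and the dimension of such a union is the maximum of $\#C$ over the faces $\{r\in H(E-A): r|_{(E-A)-C}=s_0\}$ contained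 in it (with one fixed convention for the dimension of the empty set). *)

theory Defs
  imports Complex_Main "HOL-Library.FuncSet"
begin

text \<open>Maps on a set \<open>B\<close> are extensional functions (\<open>undefined\<close> outside \<open>B\<close>), so that
  restriction is \<^term>\<open>restrict\<close>. Signs are real numbers, so that sign vectors on \<open>B\<close>
  are literally the vertices of the cube over \<open>B\<close>.\<close>

definition sign_maps :: "'a set \<Rightarrow> ('a \<Rightarrow> real) set" where
  "sign_maps B = B \<rightarrow>\<^sub>E {-1, 1}"

definition cube :: "'a set \<Rightarrow> ('a \<Rightarrow> real) set" where
  "cube B = B \<rightarrow>\<^sub>E {-1..1}"

definition shattered :: "('a \<Rightarrow> real) set \<Rightarrow> 'a set \<Rightarrow> bool" where
  "shattered L A \<longleftrightarrow> (\<lambda>s. restrict s A) ` L = sign_maps A"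

definition ample :: "'a set \<Rightarrow> ('a \<Rightarrow> real) set \<Rightarrow> bool" where
  "ample E L \<longleftrightarrow> card L = card {A. A \<subseteq> E \<and> shattered L A}"

definition proj :: "'a set \<Rightarrow> 'a set \<Rightarrow> ('a \<Rightarrow> real) set \<Rightarrow> ('a \<Rightarrow> real) set" where
  "proj E A K = (\<lambda>r. restrict r (E - A)) ` K"

definition cube_face :: "'a set \<Rightarrow> 'a set \<Rightarrow> ('a \<Rightarrow> real) \<Rightarrow> ('a \<Rightarrow> real) set" where
  "cube_face B C s = {r \<in> cube B. restrict r (B - C) = s}"

definition cube_faces :: "'a set \<Rightarrow> ('a \<Rightarrow> real) set set" where
  "cube_faces B = {cube_face B C s | C s. C \<subseteq> B \<and> s \<in> sign_maps (B - C)}"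

definition realization :: "'a set \<Rightarrow> ('a \<Rightarrow> real) set \<Rightarrow> ('a \<Rightarrow> real) set" where
  "realization B M = \<Union> {F \<in> cube_faces B. F \<inter> sign_maps B \<subseteq> M}"

text \<open>Topological dimension of a union \<open>X\<close> of faces of the cube over the finite set \<open>B\<close>: the largest
  number of free coordinates of a face contained in \<open>X\<close>, with value \<open>-1\<close> for the empty set. It is only
  meaningful when \<open>X\<close> is such a union.\<close>

definition cubical_dim :: "'a set \<Rightarrow> ('a \<Rightarrow> real) set \<Rightarrow> int" where
  "cubical_dim B X =
     Max (insert (-1) {int (card C) | C s. C \<subseteq> B \<and> s \<in> sign_maps (B - C) \<and> cube_face B C s \<subseteq> X})"

end

theory Submission
  imports Defs
begin

text \<open>Splitting \<open>L\<close> along a coordinate gives Pajor's inequality: \<open>L\<close> has at most as many elements as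
  shattered sets. If equality holds, then it holds for both halves, and every shattered set avoiding
  the coordinate is shattered by one of them. Hence ampleness passes to faces, and an ample set
  contains a \<open>C\<close>-face whenever it shatters \<open>C\<close>; this lifts the faces of \<open>|L\<^sub>A|\<close> to faces of \<open>|L|\<close>.
  Conversely, equal dimensions force a \<open>C\<close>-face in \<open>L\<close> for each shattered \<open>C\<close>. As \<open>L\<close> contains
  a \<open>C\<close>-face iff its complement does not shatter \<open>E - C\<close>, Pajor's inequality for the complement bounds
  the number of such \<open>C\<close> by the cardinality of \<open>L\<close>.\<close>

section \<open>Sign maps, shattering and cube faces\<close>

definition shattered_sets :: "'a set \<Rightarrow> ('a \<Rightarrow> real) set \<Rightarrow> 'a set set" where
  "shattered_sets E L = {A. A \<subseteq> E \<and> shattered L A}"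

text \<open>All vertices of some face with free coordinates \<open>C\<close> lie in
  \<open>L\<close>. The base point \<open>s\<close> is a sign map on all of \<open>E\<close>, so it
  is itself such a vertex.\<close>

definition contains_face :: "'a set \<Rightarrow> ('a \<Rightarrow> real) set \<Rightarrow> 'a set \<Rightarrow> bool" where
  "contains_face E L C \<longleftrightarrow>
     (\<exists>s\<in>sign_maps E. \<forall>t\<in>sign_maps E. (\<forall>x\<in>E - C. t x = s x) \<longrightarrow> t \<in> L)"

lemma ample_iff: "ample E L \<longleftrightarrow> card L = card (shattered_sets E L)"
  by (simp add: ample_def shattered_sets_def)

lemma finite_sign_maps: "finite E \<Longrightarrow> finite (sign_maps E)"
  by (simp add: sign_maps_def finite_PiE)

lemma card_sign_maps: "finite E \<Longrightarrow> card (sign_maps E) = 2 ^ card E"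
  by (simp add: sign_maps_def card_PiE numeral_2_eq_2)

lemma finite_shattered_sets: "finite E \<Longrightarrow> finite (shattered_sets E L)"
  by (rule finite_subset[of _ "Pow E"]) (auto simp: shattered_sets_def)

lemma sign_maps_eqI:
  "s \<in> sign_maps E \<Longrightarrow> t \<in> sign_maps E \<Longrightarrow> (\<And>x. x \<in> E \<Longrightarrow> s x = t x) \<Longrightarrow> s = t"
  unfolding sign_maps_def by (rule PiE_ext)

lemma sign_maps_values: "s \<in> sign_maps E \<Longrightarrow> x \<in> E \<Longrightarrow> s x = -1 \<or> s x = 1"
  by (auto simp: sign_maps_def)

lemma restrict_sign_maps: "s \<in> sign_maps E \<Longrightarrow> A \<subseteq> E \<Longrightarrow> restrict s A \<in> sign_maps A"
  by (auto simp: sign_maps_def)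

text \<open>Restrictions of sign maps are sign maps, so the image equality reduces to surjectivity,
  stated pointwise.\<close>

lemma shattered_iff:
  assumes "L \<subseteq> sign_maps E" "A \<subseteq> E"
  shows "shattered L A \<longleftrightarrow> (\<forall>t\<in>sign_maps A. \<exists>s\<in>L. \<forall>x\<in>A. s x = t x)"
proof
  assume "shattered L A"
  then have eq: "(\<lambda>s. restrict s A) ` L = sign_maps A" by (simp add: shattered_def)
  show "\<forall>t\<in>sign_maps A. \<exists>s\<in>L. \<forall>x\<in>A. s x = t x"
    unfolding eq[symmetric] by auto
next
  assume R: "\<forall>t\<in>sign_maps A. \<exists>s\<in>L. \<forall>x\<in>A. s x = t x"
  have "t \<in> (\<lambda>s. restrict s A) ` L" if t: "t \<in> sign_maps A" for t
  proof -
    obtain s where s: "s \<in> L" "\<forall>x\<in>A. s x = t x" using R t by blast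
    have "restrict s A = t"
      using s assms t by (intro sign_maps_eqI[OF restrict_sign_maps]) auto
    then show ?thesis using s by blast
  qed
  then show "shattered L A"
    using assms restrict_sign_maps unfolding shattered_def by blast
qed

lemma shattered_mono:
  "L \<subseteq> M \<Longrightarrow> M \<subseteq> sign_maps E \<Longrightarrow> A \<subseteq> E \<Longrightarrow> shattered L A \<Longrightarrow> shattered M A"
  using shattered_iff[of L E A] shattered_iff[of M E A] by (metis order_trans subsetD)

lemma shattered_sets_mono:
  "L \<subseteq> M \<Longrightarrow> M \<subseteq> sign_maps E \<Longrightarrow> shattered_sets E L \<subseteq> shattered_sets E M"
  by (auto simp: shattered_sets_def intro: shattered_mono)

text \<open>The two constant sign maps on \<open>A\<close> differ at \<open>e\<close>, so they
  cannot both be restrictions of elements of \<open>L\<close>.\<close>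

lemma not_shattered_constant:
  assumes "L \<subseteq> sign_maps E" "A \<subseteq> E" "e \<in> A" "\<And>s. s \<in> L \<Longrightarrow> s e = c"
  shows "\<not> shattered L A"
proof
  assume sh: "shattered L A"
  have "(\<lambda>x\<in>A. 1) \<in> sign_maps A" "(\<lambda>x\<in>A. -1) \<in> sign_maps A"
    by (auto simp: sign_maps_def)
  then have "\<exists>s\<in>L. s e = 1" "\<exists>s\<in>L. s e = -1"
    using sh assms(3) unfolding shattered_iff[OF assms(1,2)] by fastforce+
  then obtain s t where "s \<in> L" "s e = 1" "t \<in> L" "t e = -1" by blast
  then show False using assms(4)[of s] assms(4)[of t] by simp
qed

section \<open>Splitting along a coordinate and Pajor's inequality\<close>

definition half :: "('a \<Rightarrow> real) set \<Rightarrow> 'a \<Rightarrow> real \<Rightarrow> ('a \<Rightarrow> real) set" where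
  "half L e c = {s \<in> L. s e = c}"

lemma half_subset: "half L e c \<subseteq> L"
  by (auto simp: half_def)

text \<open>Provides the strict descent for the inductions on \<open>card L\<close>: a half cannot
  contain both \<open>s\<close> and \<open>t\<close>.\<close>

lemma half_psubset:
  assumes "s \<in> L" "t \<in> L" "s e \<noteq> t e"
  shows "half L e c \<subset> L"
proof -
  have "s \<notin> half L e c \<or> t \<notin> half L e c" using assms(3) by (auto simp: half_def)
  then show ?thesis using half_subset[of L e c] assms(1,2) by auto
qed

lemma card_halves:
  assumes "finite E" "L \<subseteq> sign_maps E" "e \<in> E"
  shows "card L = card (half L e (-1)) + card (half L e 1)"
proof -
  have "L = half L e (-1) \<union> half L e 1"
    using assms(2,3) sign_maps_values by (fastforce simp: half_def)
  moreover have "finite L" using assms finite_sign_maps finite_subset by blast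
  moreover have "half L e (-1) \<inter> half L e 1 = {}" by (auto simp: half_def)
  ultimately show ?thesis
    by (metis card_Un_disjoint finite_Un)
qed

text \<open>The value of a pattern at \<open>e\<close> selects a half, and that half realizes the
  rest of the pattern on \<open>A\<close>.\<close>

lemma insert_shattered:
  assumes "L \<subseteq> sign_maps E" "A \<subseteq> E" "e \<in> E"
    and "shattered (half L e (-1)) A" "shattered (half L e 1) A"
  shows "shattered L (insert e A)"
proof -
  have sub: "half L e c \<subseteq> sign_maps E" for c using assms(1) by (auto simp: half_def)
  have "\<exists>s\<in>L. \<forall>x\<in>insert e A. s x = t x" if t: "t \<in> sign_maps (insert e A)" for t
  proof -
    have tA: "restrict t A \<in> sign_maps A" using t restrict_sign_maps by blast
    have "t e = -1 \<or> t e = 1" using sign_maps_values[OF t, of e] by simp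
    then have "shattered (half L e (t e)) A" using assms(4,5) by auto
    then obtain s where "s \<in> half L e (t e)" "\<forall>x\<in>A. s x = restrict t A x"
      using tA shattered_iff[OF sub assms(2)] by blast
    then show ?thesis by (auto simp: half_def)
  qed
  then show ?thesis
    using assms(1-3) by (subst shattered_iff[of L E]) auto
qed

text \<open>A set shattered by both halves is counted twice in the sum; its second copy becomes its
  extension by \<open>e\<close>. No half shatters a set containing \<open>e\<close>, so these
  extensions are new and pairwise distinct.\<close>

lemma shattered_sets_halves:
  assumes "finite E" "L \<subseteq> sign_maps E" "e \<in> E"
  defines "S \<equiv> \<lambda>c. shattered_sets E (half L e c)"
  defines "T \<equiv> (S (-1) \<union> S 1) \<union> insert e ` (S (-1) \<inter> S 1)"
  shows "T \<subseteq> shattered_sets E L" and "card T = card (S (-1)) + card (S 1)"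
    and "A \<in> T \<Longrightarrow> e \<notin> A \<Longrightarrow> A \<in> S (-1) \<or> A \<in> S 1"
proof -
  have sub: "half L e c \<subseteq> sign_maps E" for c using assms(2) by (auto simp: half_def)
  have fin: "finite (S c)" for c using assms(1) by (simp add: S_def finite_shattered_sets)
  have notin: "e \<notin> A" if "A \<in> S c" for A c
  proof
    assume "e \<in> A"
    moreover have "A \<subseteq> E" "shattered (half L e c) A"
      using that by (auto simp: S_def shattered_sets_def)
    ultimately show False using not_shattered_constant[OF sub] by (force simp: half_def)
  qed
  show "T \<subseteq> shattered_sets E L"
    using shattered_sets_mono[OF half_subset assms(2)] insert_shattered[OF assms(2) _ assms(3)] assms(3)
    unfolding T_def S_def by (auto simp: shattered_sets_def)
  have "inj_on (insert e) (S (-1) \<inter> S 1)"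
    by (rule inj_onI) (metis IntD1 insert_ident notin)
  moreover have "(S (-1) \<union> S 1) \<inter> insert e ` (S (-1) \<inter> S 1) = {}"
    using notin by blast
  ultimately have "card T = card (S (-1) \<union> S 1) + card (S (-1) \<inter> S 1)"
    unfolding T_def using fin by (subst card_Un_disjoint) (auto simp: card_image)
  then show "card T = card (S (-1)) + card (S 1)"
    using card_Un_Int[OF fin fin, of "-1" 1] by simp
  show "A \<in> T \<Longrightarrow> e \<notin> A \<Longrightarrow> A \<in> S (-1) \<or> A \<in> S 1"
    by (auto simp: T_def)
qed

text \<open>Two distinct elements differ at some \<open>e\<close>; both halves are then smaller, and
  their bounds add up.\<close>

lemma pajor:
  assumes "finite E" "L \<subseteq> sign_maps E"
  shows "card L \<le> card (shattered_sets E L)"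
  using assms(2)
proof (induction "card L" arbitrary: L rule: less_induct)
  case less
  have finL: "finite L" using less.prems assms(1) finite_sign_maps finite_subset by blast
  show ?case
  proof (cases "\<exists>s\<in>L. \<exists>t\<in>L. s \<noteq> t")
    case True
    then obtain s t e where st: "s \<in> L" "t \<in> L" "e \<in> E" "s e \<noteq> t e"
      using less.prems sign_maps_eqI by (metis subsetD)
    have le: "card (half L e c) \<le> card (shattered_sets E (half L e c))" for c
    proof -
      have "half L e c \<subset> L" using st half_psubset by metis
      then show ?thesis using less finL by (meson psubset_card_mono psubset_imp_subset subset_trans)
    qed
    note halves = shattered_sets_halves[OF assms(1) less.prems st(3)]
    show ?thesis
      using card_mono[OF finite_shattered_sets[OF assms(1)] halves(1)] halves(2)
        card_halves[OF assms(1) less.prems st(3)] le[of "-1"] le[of 1] by linarith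
  next
    case False
    show ?thesis
    proof (cases "L = {}")
      case nonempty: False
      then have "card L = 1" using False by (metis card_1_singleton_iff ex_in_conv singleton_iff subsetI subset_antisym One_nat_def)
      \<comment> \<open>A singleton needs just one shattered set, and the empty set is one.\<close>
      moreover have "{} \<in> shattered_sets E L"
        using nonempty by (auto simp: shattered_sets_def shattered_iff[OF less.prems])
      ultimately show ?thesis
        using finite_shattered_sets[OF assms(1), of L]
        by (metis One_nat_def Suc_leI card_gt_0_iff empty_iff)
    qed simp
  qed
qed

section \<open>Ample sets, their faces and the faces they contain\<close>

text \<open>Equality for \<open>L\<close> leaves no slack in Pajor's inequality for either half, nor
  in the inclusion of the family \<open>T\<close> of \<open>shattered_sets_halves\<close> in the
  shattered sets of \<open>L\<close>.\<close>

lemma ample_halves: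
  assumes "finite E" "L \<subseteq> sign_maps E" "e \<in> E" "ample E L"
  shows "ample E (half L e (-1))" "ample E (half L e 1)"
    and "C \<in> shattered_sets E L \<Longrightarrow> e \<notin> C \<Longrightarrow>
      C \<in> shattered_sets E (half L e (-1)) \<or> C \<in> shattered_sets E (half L e 1)"
proof -
  have le: "card (half L e c) \<le> card (shattered_sets E (half L e c))" for c
    using pajor[OF assms(1)] assms(2) half_subset by (meson subset_trans)
  note halves = shattered_sets_halves[OF assms(1-3)]
  note fin = finite_shattered_sets[OF assms(1), of L]
  note eqs = card_mono[OF fin halves(1)] halves(2) card_halves[OF assms(1-3)]
    le[of "-1"] le[of 1] assms(4)[unfolded ample_iff]
  show "ample E (half L e (-1))" "ample E (half L e 1)"
    unfolding ample_iff using eqs by linarith+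
  assume "C \<in> shattered_sets E L" "e \<notin> C"
  then show "C \<in> shattered_sets E (half L e (-1)) \<or> C \<in> shattered_sets E (half L e 1)"
    using halves(3) card_subset_eq[OF fin halves(1)] eqs by fastforce
qed

text \<open>Fixing the coordinates in \<open>D\<close> one at a time passes to a half at each
  step.\<close>

lemma ample_face:
  assumes "finite E" "L \<subseteq> sign_maps E" "ample E L" "D \<subseteq> E" "s \<in> sign_maps D"
  shows "ample E {u \<in> L. \<forall>x\<in>D. u x = s x}"
proof -
  \<comment> \<open>An extensional \<open>s\<close> on \<open>D\<close> is not a sign map on smaller
    sets, so the induction carries only its values.\<close>
  have sgn: "\<forall>x\<in>D. s x \<in> {-1, 1}" using assms(5) by (auto simp: sign_maps_def)
  have "finite D" using assms(1,4) finite_subset by blast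
  then show ?thesis using assms(4) sgn
  proof (induction D)
    case empty
    then show ?case using assms(3) by simp
  next
    case (insert e D)
    let ?M = "{u \<in> L. \<forall>x\<in>D. u x = s x}"
    have "{u \<in> L. \<forall>x\<in>insert e D. u x = s x} = half ?M e (s e)"
      by (auto simp: half_def)
    moreover have "ample E ?M" using insert.IH insert.prems by simp
    moreover have "?M \<subseteq> sign_maps E" using assms(2) by auto
    moreover have "e \<in> E" "s e = -1 \<or> s e = 1" using insert.prems by simp_all
    ultimately show ?case
      using ample_halves(1,2)[OF assms(1), of ?M e] by (elim disjE) simp_all
  qed
qed

lemma contains_face_mono: "contains_face E L C \<Longrightarrow> L \<subseteq> M \<Longrightarrow> contains_face E M C"
  unfolding contains_face_def by blast

text \<open>As long as two elements differ outside \<open>C\<close>, some half is still ample and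
  shatters \<open>C\<close>. Once all elements agree outside \<open>C\<close>, shattering
  \<open>C\<close> makes \<open>L\<close> a full face.\<close>

lemma ample_contains_face:
  assumes "finite E" "L \<subseteq> sign_maps E" "ample E L" "C \<in> shattered_sets E L"
  shows "contains_face E L C"
  using assms(2-4)
proof (induction "card L" arbitrary: L rule: less_induct)
  case less
  have finL: "finite L" using less.prems(1) assms(1) finite_sign_maps finite_subset by blast
  have C: "C \<subseteq> E" "shattered L C" using less.prems(3) by (auto simp: shattered_sets_def)
  show ?case
  proof (cases "\<exists>s\<in>L. \<exists>t\<in>L. \<exists>e\<in>E - C. s e \<noteq> t e")
    case True
    then obtain s t e where st: "s \<in> L" "t \<in> L" "e \<in> E" "e \<notin> C" "s e \<noteq> t e" by blast
    note halves = ample_halves[OF assms(1) less.prems(1) st(3) less.prems(2)]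
    obtain c where c: "ample E (half L e c)" "C \<in> shattered_sets E (half L e c)"
      using halves(1,2) halves(3)[OF less.prems(3) st(4)] by blast
    have "half L e c \<subset> L" using st half_psubset by metis
    then have "card (half L e c) < card L" "half L e c \<subseteq> sign_maps E"
      using finL psubset_card_mono less.prems(1) by auto
    then have "contains_face E (half L e c) C" using less.hyps c by simp
    then show ?thesis using half_subset by (rule contains_face_mono)
  next
    case False
    have "\<exists>s\<in>L. \<forall>x\<in>C. s x = t x" if "t \<in> sign_maps E" for t
    proof -
      have "restrict t C \<in> sign_maps C" using that C restrict_sign_maps by blast
      then show ?thesis using C(2) unfolding shattered_iff[OF less.prems(1) C(1)] by fastforce
    qed
    note ex = this
    \<comment> \<open>Any sign map serves here: matching it on \<open>C\<close> shows that
      \<open>L\<close> is nonempty.\<close>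
    have "(\<lambda>x\<in>E. 1) \<in> sign_maps E" by (auto simp: sign_maps_def)
    then obtain s where s: "s \<in> L" using ex by blast
    have "t \<in> L" if t: "t \<in> sign_maps E" "\<forall>x\<in>E - C. t x = s x" for t
    proof -
      \<comment> \<open>The element matching \<open>t\<close> on \<open>C\<close> is
        \<open>t\<close> itself, since outside \<open>C\<close> both agree with
        \<open>s\<close>.\<close>
      obtain u where u: "u \<in> L" "\<forall>x\<in>C. u x = t x" using ex t(1) by blast
      have "u x = t x" if "x \<in> E" for x
      proof (cases "x \<in> C")
        case notC: False
        then have "u x = s x" using False u(1) s that by blast
        then show ?thesis using t(2) that notC by simp
      qed (use u(2) in simp)
      then have "u = t" using u(1) t(1) less.prems(1) by (intro sign_maps_eqI) auto
      then show ?thesis using u by simp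
    qed
    then show ?thesis using s less.prems(1) unfolding contains_face_def by blast
  qed
qed

section \<open>Duality with the complement and counting faces\<close>

text \<open>A face over a fixed pattern on \<open>E - C\<close> fails to lie in \<open>L\<close>
  exactly when the complement realizes that pattern.\<close>

lemma contains_face_iff_complement:
  assumes "C \<subseteq> E"
  shows "contains_face E L C \<longleftrightarrow> \<not> shattered (sign_maps E - L) (E - C)"
proof -
  have "shattered (sign_maps E - L) (E - C) \<longleftrightarrow>
      (\<forall>t\<in>sign_maps (E - C). \<exists>s\<in>sign_maps E - L. \<forall>x\<in>E - C. s x = t x)"
    by (rule shattered_iff) auto
  also have "\<dots> \<longleftrightarrow> (\<forall>t\<in>sign_maps E. \<exists>s\<in>sign_maps E - L. \<forall>x\<in>E - C. s x = t x)"
  proof (intro iffI ballI)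
    fix t assume *: "\<forall>t\<in>sign_maps (E - C). \<exists>s\<in>sign_maps E - L. \<forall>x\<in>E - C. s x = t x"
      and t: "t \<in> sign_maps E"
    have "restrict t (E - C) \<in> sign_maps (E - C)" using t restrict_sign_maps by blast
    then obtain s where "s \<in> sign_maps E - L" "\<forall>x\<in>E - C. s x = restrict t (E - C) x"
      using * by blast
    then show "\<exists>s\<in>sign_maps E - L. \<forall>x\<in>E - C. s x = t x" by (intro bexI[of _ s]) auto
  next
    fix t assume *: "\<forall>t\<in>sign_maps E. \<exists>s\<in>sign_maps E - L. \<forall>x\<in>E - C. s x = t x"
      and t: "t \<in> sign_maps (E - C)"
    \<comment> \<open>Extends the pattern to all of \<open>E\<close>, with an arbitrary sign on
      \<open>C\<close>.\<close>
    have "(\<lambda>x\<in>E. if x \<in> C then 1 else t x) \<in> sign_maps E"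
      using t by (auto simp: sign_maps_def PiE_iff)
    then obtain s where
      "s \<in> sign_maps E - L" "\<forall>x\<in>E - C. s x = (\<lambda>x\<in>E. if x \<in> C then 1 else t x) x"
      using * by blast
    then show "\<exists>s\<in>sign_maps E - L. \<forall>x\<in>E - C. s x = t x" by (intro bexI[of _ s]) auto
  qed
  finally show ?thesis unfolding contains_face_def by blast
qed

text \<open>With \<open>n = card E\<close>, duality counts these \<open>C\<close> as
  \<open>2 ^ n\<close> minus the number of sets shattered by the complement, which by Pajor's
  inequality is at least \<open>2 ^ n - card L\<close>.\<close>

lemma card_contains_face_le:
  assumes "finite E" "L \<subseteq> sign_maps E"
  shows "card {C. C \<subseteq> E \<and> contains_face E L C} \<le> card L"
proof -
  let ?S = "shattered_sets E (sign_maps E - L)" and ?F = "{C. C \<subseteq> E \<and> contains_face E L C}"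
  have "?F = Pow E - (\<lambda>A. E - A) ` ?S"
  proof (intro set_eqI iffI)
    fix C assume "C \<in> ?F"
    then show "C \<in> Pow E - (\<lambda>A. E - A) ` ?S"
      by (auto simp: contains_face_iff_complement shattered_sets_def double_diff)
  next
    fix C assume C: "C \<in> Pow E - (\<lambda>A. E - A) ` ?S"
    then have "E - C \<notin> ?S" by (metis (no_types, lifting) DiffD1 DiffD2 PowD double_diff image_eqI order_refl)
    then show "C \<in> ?F" using C by (auto simp: contains_face_iff_complement shattered_sets_def)
  qed
  moreover have "card ((\<lambda>A. E - A) ` ?S) = card ?S"
    by (rule card_image, rule inj_onI) (auto simp: shattered_sets_def)
  moreover have "(\<lambda>A. E - A) ` ?S \<subseteq> Pow E" by auto
  ultimately have "card ?F = 2 ^ card E - card ?S"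
    using assms(1) finite_shattered_sets[OF assms(1)] by (simp add: card_Diff_subset card_Pow)
  moreover have "2 ^ card E - card L \<le> card ?S"
    using pajor[OF assms(1), of "sign_maps E - L"] card_Diff_subset[of L "sign_maps E"]
      card_sign_maps[OF assms(1)] finite_subset[OF assms(2) finite_sign_maps[OF assms(1)]] assms(2)
    by simp
  moreover have "card L \<le> 2 ^ card E"
    using card_mono[OF finite_sign_maps[OF assms(1)] assms(2)] card_sign_maps[OF assms(1)] by simp
  ultimately show ?thesis by linarith
qed

text \<open>If every shattered set is the free set of a face in \<open>L\<close>, the face count
  bounds the number of shattered sets by \<open>card L\<close>; Pajor's inequality is the reverse
  bound.\<close>

lemma ample_iff_contains_face:
  assumes "finite E" "L \<subseteq> sign_maps E"
  shows "ample E L \<longleftrightarrow> (\<forall>C\<in>shattered_sets E L. contains_face E L C)"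
proof
  assume "\<forall>C\<in>shattered_sets E L. contains_face E L C"
  then have "shattered_sets E L \<subseteq> {C. C \<subseteq> E \<and> contains_face E L C}"
    by (auto simp: shattered_sets_def)
  then have "card (shattered_sets E L) \<le> card {C. C \<subseteq> E \<and> contains_face E L C}"
    using assms(1) by (intro card_mono) auto
  then show "ample E L"
    using card_contains_face_le[OF assms] pajor[OF assms] by (simp add: ample_iff)
qed (use ample_contains_face[OF assms] in blast)

section \<open>Realizations and projections\<close>

text \<open>Sign maps are points of the cube, so the vertices of a face are the sign maps agreeing
  with \<open>s\<close> on its fixed coordinates.\<close>

lemma mem_realization_iff:
  "r \<in> realization B M \<longleftrightarrow> r \<in> cube B \<and> (\<exists>C\<subseteq>B. \<exists>s\<in>sign_maps (B - C).
     (\<forall>x\<in>B - C. r x = s x) \<and> (\<forall>t\<in>sign_maps B. (\<forall>x\<in>B - C. t x = s x) \<longrightarrow> t \<in> M))"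
proof -
  have eq: "cube_face B C s = {r \<in> cube B. \<forall>x\<in>B - C. r x = s x}"
    if "s \<in> sign_maps (B - C)" for s C
    using that by (auto simp: cube_face_def fun_eq_iff restrict_def sign_maps_def)
  have "sign_maps B \<subseteq> cube B"
    unfolding sign_maps_def cube_def by (rule PiE_mono) auto
  then have "cube_face B C s \<inter> sign_maps B \<subseteq> M \<longleftrightarrow>
      (\<forall>t\<in>sign_maps B. (\<forall>x\<in>B - C. t x = s x) \<longrightarrow> t \<in> M)"
    if "s \<in> sign_maps (B - C)" for s C
    unfolding eq[OF that] by blast
  moreover have "r \<in> realization B M \<longleftrightarrow> (\<exists>C\<subseteq>B. \<exists>s\<in>sign_maps (B - C).
      r \<in> cube_face B C s \<and> cube_face B C s \<inter> sign_maps B \<subseteq> M)"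
    unfolding realization_def cube_faces_def by blast
  ultimately show ?thesis using eq by simp blast
qed

lemma realizationI:
  assumes "r \<in> cube B" "C \<subseteq> B" "s \<in> sign_maps (B - C)" "\<forall>x\<in>B - C. r x = s x"
    and "\<And>t. t \<in> sign_maps B \<Longrightarrow> \<forall>x\<in>B - C. t x = s x \<Longrightarrow> t \<in> M"
  shows "r \<in> realization B M"
  unfolding mem_realization_iff
  by (intro conjI exI[of _ C] bexI[of _ s] ballI impI) (use assms in simp_all)

text \<open>A face with free set \<open>C\<close> projects into the face with free set
  \<open>C - A\<close>, whose vertices all lift to vertices of the original face.\<close>

lemma proj_realization_subset:
  "proj E A (realization E L) \<subseteq> realization (E - A) (proj E A L)"
proof
  fix r' assume "r' \<in> proj E A (realization E L)"
  then obtain r where r: "r \<in> realization E L" "r' = restrict r (E - A)"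
    by (auto simp: proj_def)
  then obtain C s where Cs: "r \<in> cube E" "C \<subseteq> E" "s \<in> sign_maps (E - C)" "\<forall>x\<in>E - C. r x = s x"
    "\<forall>t\<in>sign_maps E. (\<forall>x\<in>E - C. t x = s x) \<longrightarrow> t \<in> L"
    unfolding mem_realization_iff by blast
  have "r' \<in> cube (E - A)" using Cs(1) r(2) by (auto simp: cube_def)
  moreover have "C - A \<subseteq> E - A" using Cs(2) by auto
  moreover have "restrict s (E - A - (C - A)) \<in> sign_maps (E - A - (C - A))"
    using Cs(3) by (rule restrict_sign_maps) auto
  moreover have "\<forall>x\<in>E - A - (C - A). r' x = restrict s (E - A - (C - A)) x"
    using Cs(4) r(2) by auto
  moreover have "t \<in> proj E A L"
    if t: "t \<in> sign_maps (E - A)" "\<forall>x\<in>E - A - (C - A). t x = restrict s (E - A - (C - A)) x" for t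
  proof -
    \<comment> \<open>The lift takes \<open>t\<close> off \<open>A\<close>, the fixed values
      \<open>s\<close> on \<open>A - C\<close>, and an arbitrary sign on the remaining free
      coordinates.\<close>
    define u where "u = (\<lambda>x\<in>E. if x \<notin> A then t x else if x \<notin> C then s x else 1)"
    have "u \<in> sign_maps E"
      using t(1) Cs(3) by (auto simp: u_def sign_maps_def PiE_iff)
    moreover have "\<forall>x\<in>E - C. u x = s x" using t(2) by (auto simp: u_def)
    ultimately have "u \<in> L" using Cs(5) by blast
    moreover have "restrict u (E - A) = t"
      using t(1) by (auto simp: u_def sign_maps_def fun_eq_iff restrict_def)
    ultimately show ?thesis by (auto simp: proj_def)
  qed
  ultimately show "r' \<in> realization (E - A) (proj E A L)"
    by (rule realizationI)
qed

text \<open>The elements of \<open>L\<close> above a face of the projection form an ample set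
  shattering \<open>C\<close>. This set contains a \<open>C\<close>-face, whose constant values on
  \<open>A\<close> supply the missing coordinates of \<open>r\<close>.\<close>

lemma ample_realization_subset_proj:
  assumes "finite E" "L \<subseteq> sign_maps E" "ample E L" "A \<subseteq> E"
  shows "realization (E - A) (proj E A L) \<subseteq> proj E A (realization E L)"
proof
  fix r assume "r \<in> realization (E - A) (proj E A L)"
  then obtain C s where Cs: "r \<in> cube (E - A)" "C \<subseteq> E - A" "s \<in> sign_maps (E - A - C)"
    "\<forall>x\<in>E - A - C. r x = s x"
    "\<forall>t\<in>sign_maps (E - A). (\<forall>x\<in>E - A - C. t x = s x) \<longrightarrow> t \<in> proj E A L"
    unfolding mem_realization_iff by blast
  define L' where "L' = {u \<in> L. \<forall>x\<in>E - A - C. u x = s x}"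
  have L': "L' \<subseteq> sign_maps E" using assms(2) by (auto simp: L'_def)
  have "ample E L'"
    unfolding L'_def using Cs(3) by (intro ample_face assms) auto
  moreover have "C \<in> shattered_sets E L'"
  proof -
    have "\<exists>u\<in>L'. \<forall>x\<in>C. u x = t x" if t: "t \<in> sign_maps C" for t
    proof -
      \<comment> \<open>The vertex of the projected face with pattern \<open>t\<close> on
        \<open>C\<close>; its lift to \<open>L\<close> lies in \<open>L'\<close>.\<close>
      define v where "v = (\<lambda>x\<in>E - A. if x \<in> C then t x else s x)"
      have "v \<in> sign_maps (E - A)" using t Cs(3) by (auto simp: v_def sign_maps_def PiE_iff)
      then have "v \<in> proj E A L" using Cs(5) by (auto simp: v_def)
      then obtain u where u: "u \<in> L" "v = restrict u (E - A)" by (auto simp: proj_def)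
      have "u x = v x" if "x \<in> E - A" for x using u that by simp
      then have "u \<in> L'" "\<forall>x\<in>C. u x = t x" using u(1) Cs(2) by (auto simp: L'_def v_def)
      then show ?thesis by blast
    qed
    moreover have "C \<subseteq> E" using Cs(2) by blast
    ultimately show ?thesis using shattered_iff[OF L', of C] by (auto simp: shattered_sets_def)
  qed
  ultimately have "contains_face E L' C"
    using ample_contains_face[OF assms(1) L'] by blast
  then obtain u where u: "u \<in> sign_maps E"
    "\<forall>t\<in>sign_maps E. (\<forall>x\<in>E - C. t x = u x) \<longrightarrow> t \<in> L'"
    unfolding contains_face_def by blast
  have uL': "u \<in> L'" using u by blast
  define r' where "r' = (\<lambda>x\<in>E. if x \<in> A then u x else r x)"
  have "r' x \<in> {-1..1}" if "x \<in> E" for x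
    using that Cs(1) sign_maps_values[OF u(1) that] by (auto simp: r'_def cube_def PiE_iff)
  then have "r' \<in> cube E" by (auto simp: cube_def r'_def)
  moreover have "C \<subseteq> E" using Cs(2) by blast
  moreover have "restrict u (E - C) \<in> sign_maps (E - C)" using u(1) restrict_sign_maps by blast
  \<comment> \<open>On \<open>A\<close> this is the choice of \<open>r'\<close>; elsewhere both
    sides equal \<open>s\<close>, because \<open>u\<close> lies in \<open>L'\<close>.\<close>
  moreover have "\<forall>x\<in>E - C. r' x = restrict u (E - C) x"
    using uL' Cs(4) by (auto simp: r'_def L'_def)
  moreover have "t \<in> L" if "t \<in> sign_maps E" "\<forall>x\<in>E - C. t x = restrict u (E - C) x" for t
  proof -
    have "\<forall>x\<in>E - C. t x = u x" using that(2) by simp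
    then have "t \<in> L'" using u(2) that(1) by blast
    then show ?thesis by (simp add: L'_def)
  qed
  ultimately have "r' \<in> realization E L" by (rule realizationI)
  moreover have "restrict r' (E - A) = r"
    using Cs(1) by (auto simp: r'_def cube_def fun_eq_iff restrict_def)
  ultimately show "r \<in> proj E A (realization E L)" by (auto simp: proj_def)
qed

section \<open>Full dimension and the recovery of faces\<close>

text \<open>Only \<open>C = B\<close> has \<open>card B\<close> elements, and the face with all
  coordinates free is the whole cube.\<close>

lemma cubical_dim_eq_card_iff:
  assumes "finite B"
  shows "cubical_dim B X = int (card B) \<longleftrightarrow> cube B \<subseteq> X"
proof -
  let ?D = "{int (card C) | C s. C \<subseteq> B \<and> s \<in> sign_maps (B - C) \<and> cube_face B C s \<subseteq> X}"
  have fin: "finite (insert (-1) ?D)"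
    using assms by (intro finite.insertI finite_subset[of ?D "(\<lambda>C. int (card C)) ` Pow B"]) auto
  have le: "d \<le> int (card B)" if "d \<in> insert (-1) ?D" for d
    using that assms by (auto intro: card_mono)
  have full: "cube_face B B s = cube B" if "s \<in> sign_maps {}" for s
    using that by (auto simp: cube_face_def sign_maps_def restrict_def)
  have "cubical_dim B X = int (card B) \<longleftrightarrow> int (card B) \<in> insert (-1) ?D"
    unfolding cubical_dim_def by (subst Max_eq_iff[OF fin]) (use le in blast)+
  also have "\<dots> \<longleftrightarrow> cube B \<subseteq> X"
  proof
    assume "int (card B) \<in> insert (-1) ?D"
    \<comment> \<open>The default \<open>-1\<close> is ruled out, as a cardinality is
      nonnegative.\<close>
    then obtain C s where "card C = card B" "C \<subseteq> B" "s \<in> sign_maps (B - C)" "cube_face B C s \<subseteq> X"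
      by auto
    then show "cube B \<subseteq> X" using full card_subset_eq[OF assms] by (metis Diff_cancel)
  next
    assume "cube B \<subseteq> X"
    moreover have "(\<lambda>_. undefined) \<in> sign_maps (B - B)" by (simp add: sign_maps_def)
    ultimately show "int (card B) \<in> insert (-1) ?D" using full by fastforce
  qed
  finally show ?thesis .
qed

lemma realization_sign_maps: "cube B \<subseteq> realization B (sign_maps B)"
proof
  fix r assume "r \<in> cube B"
  moreover have "(\<lambda>_. undefined) \<in> sign_maps (B - B)" by (simp add: sign_maps_def)
  ultimately show "r \<in> realization B (sign_maps B)" unfolding mem_realization_iff by blast
qed

text \<open>The centre of the cube over \<open>C\<close> lifts to a point of a face in the
  realization of \<open>L\<close>. Since 0 is not a sign, that face has every coordinate of
  \<open>C\<close> free.\<close>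

lemma contains_face_of_cube_subset_proj:
  assumes "C \<subseteq> E" "cube C \<subseteq> proj E (E - C) (realization E L)"
  shows "contains_face E L C"
proof -
  have "(\<lambda>x\<in>C. 0) \<in> cube C" by (auto simp: cube_def)
  then obtain r where r: "r \<in> realization E L" "(\<lambda>x\<in>C. 0) = restrict r (E - (E - C))"
    using assms(2) by (auto simp: proj_def)
  have r0: "r x = 0" if "x \<in> C" for x
    using fun_cong[OF r(2), of x] that assms(1) by auto
  obtain D s where Ds: "D \<subseteq> E" "s \<in> sign_maps (E - D)" "\<forall>x\<in>E - D. r x = s x"
    "\<forall>t\<in>sign_maps E. (\<forall>x\<in>E - D. t x = s x) \<longrightarrow> t \<in> L"
    using r(1) unfolding mem_realization_iff by blast
  have CD: "C \<subseteq> D"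
  proof
    fix x assume x: "x \<in> C"
    show "x \<in> D"
      using r0[OF x] Ds(3) sign_maps_values[OF Ds(2), of x] x assms(1) by (cases "x \<in> D") auto
  qed
  \<comment> \<open>A vertex of the \<open>D\<close>-face as base point: agreeing with it off
    \<open>C\<close> implies agreeing with \<open>s\<close> off \<open>D\<close>.\<close>
  have "(\<lambda>x\<in>E. if x \<in> D then 1 else s x) \<in> sign_maps E"
    using Ds(2) by (auto simp: sign_maps_def PiE_iff)
  then show ?thesis
    unfolding contains_face_def using Ds(4) CD by (rule_tac bexI) auto
qed

theorem theorem3:
  fixes E :: "'a set" and L :: "('a \<Rightarrow> real) set"
  assumes "finite E" and "L \<subseteq> sign_maps E"
  shows "(ample E L \<longleftrightarrow>
            (\<forall>A\<subseteq>E. proj E A (realization E L) = realization (E - A) (proj E A L)))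
       \<and> (ample E L \<longleftrightarrow>
            (\<forall>A\<subseteq>E. cubical_dim (E - A) (proj E A (realization E L))
                   = cubical_dim (E - A) (realization (E - A) (proj E A L))))"
    (is "(_ \<longleftrightarrow> ?ii) \<and> (_ \<longleftrightarrow> ?iii)")
proof -
  have "ample E L \<Longrightarrow> ?ii"
    using proj_realization_subset ample_realization_subset_proj[OF assms] by blast
  moreover have "?ii \<Longrightarrow> ?iii" by simp
  moreover have "ample E L" if iii: ?iii
  proof -
    have "contains_face E L C" if C: "C \<in> shattered_sets E L" for C
    proof -
      have CE: "C \<subseteq> E" "E - (E - C) = C" using C by (auto simp: shattered_sets_def)
      have finC: "finite C" using CE(1) assms(1) finite_subset by blast
      \<comment> \<open>Projecting along \<open>E - C\<close> restricts to \<open>C\<close>, so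
        shattering gives the projected set a realization of full dimension; (iii) transfers this to
        the projected realization.\<close>
      have "proj E (E - C) L = sign_maps C"
        using C CE by (simp add: proj_def shattered_sets_def shattered_def)
      then have "cubical_dim C (realization C (proj E (E - C) L)) = int (card C)"
        using realization_sign_maps cubical_dim_eq_card_iff[OF finC] by metis
      then have "cubical_dim C (proj E (E - C) (realization E L)) = int (card C)"
        using iii[rule_format, of "E - C"] CE by simp
      then show ?thesis
        using contains_face_of_cube_subset_proj CE(1) cubical_dim_eq_card_iff[OF finC] by blast
    qed
    then show ?thesis using ample_iff_contains_face[OF assms] by blast
  qed
  ultimately show ?thesis by blast
qed

end
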